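(* Let $(a_i)_{i\ge 1}$ be the sequence of positive integers defined by $a_1=2$ and $a_{k+1}=a_1a_2\cdots a_k+1$ for $k\ge 1$. Let $k\ge 1$ be an integer and let $b_1\le b_2\le\ldots\le b_k$ be positive integers with $$\frac{1}{b_1}+\ldots+\frac{1}{b_k}<1.$$ Then $$\frac{1}{b_1}+\ldots+\frac{1}{b_k}\le \frac{1}{a_1}+\ldots+\frac{1}{a_k},$$ and equality holds only when $b_i=a_i$ for all $1\le i\le k$.
   Context: The sequence begins $a_1=2$, $a_2=3$, $a_3=7$, $a_4=43$. *)

theory Defs
  imports Complex_Main
begin

end

theory Submission
  imports Defs
begin

text \<open>
  The argument follows Soundararajan. Sylvester's sequence satisfies
  \<open>1/a\<^sub>1 + \<dots> + 1/a\<^sub>k = 1 - 1/(a\<^sub>1\<cdots>a\<^sub>k)\<close> (\<open>sylvester_sum_reciprocals\<close>), whereas a sum of unit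
  fractions \<open>1/b\<^sub>1 + \<dots> + 1/b\<^sub>k < 1\<close> is at most \<open>1 - 1/(b\<^sub>1\<cdots>b\<^sub>k)\<close>, having a denominator that
  divides \<open>b\<^sub>1\<cdots>b\<^sub>k\<close> (\<open>sum_unit_fractions_gap\<close>). Hence, if the sum over \<open>b\<close> is at least the sum
  over \<open>a\<close>, then \<open>1/(b\<^sub>1\<cdots>b\<^sub>k) \<le> 1/(a\<^sub>1\<cdots>a\<^sub>k)\<close>.

  By induction on \<open>k\<close>, every proper initial sum of the \<open>1/b\<^sub>i\<close> is at most the corresponding sum of
  the \<open>1/a\<^sub>i\<close>. So the \<open>1/a\<^sub>i\<close> majorize the \<open>1/b\<^sub>i\<close>, and concavity of the logarithm gives the
  opposite inequality between the products, with equality only if \<open>a\<close> and \<open>b\<close> agree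
  (\<open>majorized_prod_eq\<close>).
\<close>

lemma sum_mult_le_of_partial_sums_nonneg:
  fixes c d :: "nat \<Rightarrow> real"
  assumes "mono_on {1..k} c"
    and "\<And>j. j < k \<Longrightarrow> (\<Sum>i = 1..j. d i) \<ge> 0"
  shows "(\<Sum>i = 1..k. c i * d i) \<le> c k * (\<Sum>i = 1..k. d i)"
  using assms
proof (induction k)
  case 0
  then show ?case by simp
next
  case (Suc k)
  have "mono_on {1..k} c"
    using Suc.prems(1) by (rule mono_on_subset) auto
  then have IH: "(\<Sum>i = 1..k. c i * d i) \<le> c k * (\<Sum>i = 1..k. d i)"
    using Suc by simp
  have "c k * (\<Sum>i = 1..k. d i) \<le> c (Suc k) * (\<Sum>i = 1..k. d i)"
  proof (cases "k = 0")
    case False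
    then have "c k \<le> c (Suc k)"
      using Suc.prems(1) by (auto intro: mono_onD)
    then show ?thesis
      using Suc.prems(2)[of k] by (intro mult_right_mono) auto
  qed simp
  then show ?case
    using IH by (simp add: algebra_simps)
qed

text \<open>
  The equality case of the product inequality for majorized sequences, with \<open>1/c\<^sub>i\<close> as the
  majorized one. Since \<open>ln t \<le> t - 1\<close>, with equality only at \<open>t = 1\<close>, it suffices that
  \<open>\<Sum> (x\<^sub>i c\<^sub>i - 1) \<le> 0\<close>, which is a case of summation by parts.
\<close>

lemma majorized_prod_eq:
  fixes x c :: "nat \<Rightarrow> real"
  assumes c_pos: "\<And>i. i \<in> {1..k} \<Longrightarrow> c i > 0"
    and x_pos: "\<And>i. i \<in> {1..k} \<Longrightarrow> x i > 0"
    and c_mono: "mono_on {1..k} c"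
    and partial: "\<And>j. j < k \<Longrightarrow> (\<Sum>i = 1..j. 1 / c i) \<le> (\<Sum>i = 1..j. x i)"
    and total: "(\<Sum>i = 1..k. x i) \<le> (\<Sum>i = 1..k. 1 / c i)"
    and prods: "(\<Prod>i = 1..k. 1 / c i) \<le> (\<Prod>i = 1..k. x i)"
    and i: "i \<in> {1..k}"
  shows "x i = 1 / c i"
proof -
  define t where "t i = x i * c i" for i
  have t_pos: "t i > 0" if "i \<in> {1..k}" for i
    using c_pos[OF that] x_pos[OF that] by (simp add: t_def)
  have k: "k \<in> {1..k}" using i by auto
  have "(\<Sum>i = 1..k. t i - 1) = (\<Sum>i = 1..k. c i * (x i - 1 / c i))"
  proof (rule sum.cong)
    fix i assume "i \<in> {1..k}"
    then show "t i - 1 = c i * (x i - 1 / c i)"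
      using c_pos[of i] by (simp add: t_def field_simps)
  qed simp
  also have "\<dots> \<le> c k * (\<Sum>i = 1..k. x i - 1 / c i)"
    using c_mono partial
    by (intro sum_mult_le_of_partial_sums_nonneg) (auto simp: sum_subtractf)
  also have "\<dots> \<le> 0"
    using total c_pos[OF k] by (intro mult_nonneg_nonpos) (auto simp: sum_subtractf)
  finally have upper: "(\<Sum>i = 1..k. t i - 1) \<le> 0" .
  have prod_c: "(\<Prod>i = 1..k. c i) > 0"
    using c_pos by (intro prod_pos) auto
  have "1 \<le> (\<Prod>i = 1..k. t i)"
    using prods prod_c by (simp add: t_def prod.distrib prod_dividef field_simps)
  then have "0 \<le> ln (\<Prod>i = 1..k. t i)"
    by simp
  also have "\<dots> = (\<Sum>i = 1..k. ln (t i))"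
    using t_pos by (intro ln_prod) (auto simp: less_imp_neq[symmetric])
  finally have "(\<Sum>i = 1..k. (t i - 1) - ln (t i)) \<le> 0"
    using upper by (simp only: sum_subtractf)
  moreover have nonneg: "(t i - 1) - ln (t i) \<ge> 0" if "i \<in> {1..k}" for i
    using ln_le_minus_one[OF t_pos[OF that]] by simp
  ultimately have "(\<Sum>i = 1..k. (t i - 1) - ln (t i)) = 0"
    by (intro antisym sum_nonneg) auto
  then have "(t i - 1) - ln (t i) = 0"
    using i nonneg by (subst (asm) sum_nonneg_eq_0_iff) auto
  then have "t i = 1"
    using ln_eq_minus_one[OF t_pos[OF i]] by simp
  then show ?thesis
    using c_pos[OF i] by (simp add: t_def field_simps)
qed

lemma sum_unit_fractions_gap:
  fixes b :: "'a \<Rightarrow> nat"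
  assumes fin: "finite A"
    and pos: "\<And>i. i \<in> A \<Longrightarrow> b i > 0"
    and less: "(\<Sum>i\<in>A. 1 / real (b i)) < 1"
  shows "(\<Sum>i\<in>A. 1 / real (b i)) \<le> 1 - 1 / real (\<Prod>i\<in>A. b i)"
proof -
  define P where "P = (\<Prod>i\<in>A. b i)"
  define N where "N = (\<Sum>i\<in>A. P div b i)"
  have P_pos: "P > 0"
    using pos by (auto simp: P_def intro: prod_pos)
  have N: "real N = real P * (\<Sum>i\<in>A. 1 / real (b i))"
    unfolding N_def of_nat_sum sum_distrib_left
  proof (rule sum.cong)
    fix i assume "i \<in> A"
    then have "b i dvd P"
      using fin by (auto simp: P_def)
    then show "real (P div b i) = real P * (1 / real (b i))"
      by (simp add: real_of_nat_div)
  qed simp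
  then have "real N < real P"
    using less P_pos by simp
  then have "real (N + 1) \<le> real P"
    by (simp only: of_nat_less_iff of_nat_le_iff)
  then have "real N \<le> real P - 1"
    by simp
  then show ?thesis
    using P_pos unfolding N P_def[symmetric] by (simp add: field_simps)
qed

lemma sylvester_pos:
  fixes a :: "nat \<Rightarrow> nat"
  assumes "a 1 = 2"
    and "\<And>n. n \<ge> 1 \<Longrightarrow> a (n + 1) = (\<Prod>i = 1..n. a i) + 1"
    and "i \<ge> 1"
  shows "a i > 0"
proof (cases "i = 1")
  case False
  then show ?thesis
    using assms(2)[of "i - 1"] assms(3) by simp
qed (use assms(1) in simp)

lemma sylvester_sum_reciprocals:
  fixes a :: "nat \<Rightarrow> nat"
  assumes first: "a 1 = 2"
    and rec: "\<And>n. n \<ge> 1 \<Longrightarrow> a (n + 1) = (\<Prod>i = 1..n. a i) + 1"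
    and "k \<ge> 1"
  shows "(\<Sum>i = 1..k. 1 / real (a i)) = 1 - 1 / real (\<Prod>i = 1..k. a i)"
  using \<open>k \<ge> 1\<close>
proof (induction k rule: dec_induct)
  case base
  show ?case using first by simp
next
  case (step n)
  define P where "P = (\<Prod>i = 1..n. a i)"
  have "P > 0"
    using sylvester_pos[OF first rec] by (auto simp: P_def intro!: prod_pos)
  then have "1 - 1 / real P + 1 / real (P + 1) = 1 - 1 / real (P * (P + 1))"
    by (simp add: divide_simps) (simp add: algebra_simps add_nonneg_eq_0_iff)
  moreover have "a (Suc n) = P + 1"
    using rec[of n] step.hyps by (simp add: P_def)
  moreover have "(\<Sum>i = 1..Suc n. 1 / real (a i)) = 1 - 1 / real P + 1 / real (a (Suc n))"
    using step.IH by (simp add: P_def)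
  moreover have "(\<Prod>i = 1..Suc n. a i) = P * a (Suc n)"
    by (simp add: P_def)
  ultimately show ?case
    by (simp only:)
qed

text \<open>
  The induction step: initial sums of the \<open>1/b\<^sub>i\<close> that are bounded by those of Sylvester's sequence
  at every proper initial segment cannot reach the bound at \<open>k\<close> unless the sequences agree.
\<close>

lemma sylvester_unique_of_sum_ge:
  fixes a b :: "nat \<Rightarrow> nat"
  assumes a_first: "a 1 = 2"
    and a_rec: "\<And>n. n \<ge> 1 \<Longrightarrow> a (n + 1) = (\<Prod>i = 1..n. a i) + 1"
    and b_pos: "\<And>i. i \<in> {1..k} \<Longrightarrow> b i > 0"
    and b_mono: "mono_on {1..k} b"
    and b_sum: "(\<Sum>i = 1..k. 1 / real (b i)) < 1"
    and partial: "\<And>j. j < k \<Longrightarrow> (\<Sum>i = 1..j. 1 / real (b i)) \<le> (\<Sum>i = 1..j. 1 / real (a i))"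
    and ge: "(\<Sum>i = 1..k. 1 / real (a i)) \<le> (\<Sum>i = 1..k. 1 / real (b i))"
    and i: "i \<in> {1..k}"
  shows "b i = a i"
proof -
  have a_pos: "a i > 0" if "i \<in> {1..k}" for i
    using sylvester_pos[OF a_first a_rec] that by simp
  have "1 - 1 / real (\<Prod>i = 1..k. a i) = (\<Sum>i = 1..k. 1 / real (a i))"
    using sylvester_sum_reciprocals[OF a_first a_rec] i by simp
  also have "\<dots> \<le> (\<Sum>i = 1..k. 1 / real (b i))"
    by (rule ge)
  also have "\<dots> \<le> 1 - 1 / real (\<Prod>i = 1..k. b i)"
    using b_pos b_sum by (intro sum_unit_fractions_gap) auto
  finally have "(\<Prod>i = 1..k. 1 / real (b i)) \<le> (\<Prod>i = 1..k. 1 / real (a i))"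
    by (simp add: prod_dividef)
  moreover have "mono_on {1..k} (\<lambda>i. real (b i))"
    using b_mono by (auto simp: monotone_on_def)
  ultimately have "1 / real (a i) = 1 / real (b i)"
    using a_pos b_pos partial ge i
    by (intro majorized_prod_eq[where k = k and x = "\<lambda>i. 1 / real (a i)"]) auto
  then show ?thesis
    using a_pos[OF i] b_pos[OF i] by (simp add: field_simps)
qed

theorem mainTheorem1:
  fixes a b :: "nat \<Rightarrow> nat" and k :: nat
  assumes a_first: "a 1 = 2"
    and a_rec: "\<And>n. n \<ge> 1 \<Longrightarrow> a (n + 1) = (\<Prod>i = 1..n. a i) + 1"
    and k_pos: "k \<ge> 1"
    and b_pos: "\<And>i. i \<in> {1..k} \<Longrightarrow> b i > 0"
    and b_mono: "mono_on {1..k} b"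
    and b_sum: "(\<Sum>i = 1..k. 1 / real (b i)) < 1"
  shows "(\<Sum>i = 1..k. 1 / real (b i)) \<le> (\<Sum>i = 1..k. 1 / real (a i)) \<and>
    ((\<Sum>i = 1..k. 1 / real (b i)) = (\<Sum>i = 1..k. 1 / real (a i)) \<longrightarrow>
      (\<forall>i \<in> {1..k}. b i = a i))"
proof -
  let ?A = "\<lambda>j. \<Sum>i = 1..j. 1 / real (a i)" and ?B = "\<lambda>j. \<Sum>i = 1..j. 1 / real (b i)"
  have unique: "\<forall>i \<in> {1..j}. b i = a i"
    if "j \<le> k" "\<And>l. l < j \<Longrightarrow> ?B l \<le> ?A l" "?A j \<le> ?B j" for j
  proof -
    have sub: "{1..j} \<subseteq> {1..k}"
      using that(1) by auto
    have "?B j \<le> ?B k"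
      using sub by (intro sum_mono2) auto
    then have "?B j < 1"
      using b_sum by linarith
    moreover have "mono_on {1..j} b"
      using b_mono sub by (rule mono_on_subset)
    ultimately show ?thesis
      using sylvester_unique_of_sum_ge[OF a_first a_rec, of j b] b_pos sub that(2,3) by blast
  qed
  have bound: "?B j \<le> ?A j" if "j \<le> k" for j
    using that
  proof (induction j rule: less_induct)
    case (less j)
    show ?case
    proof (rule ccontr)
      assume gt: "\<not> ?B j \<le> ?A j"
      then have "\<forall>i \<in> {1..j}. b i = a i"
        using less by (intro unique) auto
      then have "?B j = ?A j"
        by (intro sum.cong) auto
      then show False
        using gt by simp
    qed
  qed
  then show ?thesis
    using unique[of k] by simp
qed

end
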